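(* Let $E_1,E_2$ be real Banach spaces, let $C\subset E_1$ and $Q\subset E_2$ be nonempty, closed and convex, let $A:E_1\to E_2$ be a bounded linear operator, and let $f:E_1\times E_1\to\mathbb{R}$ and $g:E_2\times E_2\to\mathbb{R}$ be bifunctions. Let $N$ be a normed space, let $M\subset N$ be a closed ball centered at $p^*$ with positive radius, and let $\tilde f:M\times E_1\times E_1\to\mathbb{R}$ and $\tilde g:M\times E_2\times E_2\to\mathbb{R}$ be functions with $\tilde f(p^*,\cdot,\cdot)=f$ and $\tilde g(p^*,\cdot,\cdot)=g$. Then the split equilibrium problem $SEP(f,g,C,Q)$ is LP well-posed by perturbations in the generalized sense if and only if its solution set $S$ is nonempty and compact and $$H(S(\epsilon),S)\to 0\ \text{ as }\ \epsilon\to 0$$ (where $\epsilon>0$).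
   Context: The split equilibrium problem $SEP(f,g,C,Q)$ is: find $(x^*,y^* )\in E_1\times E_2$ such that $x^*\in C$, $y^*\in Q$, $y^*=Ax^*$, $f(x^*,x)\ge 0$ for all $x\in C$, and $g(y^*,y)\ge 0$ for all $y\in Q$. Its solution set is denoted by $S$. The space $E_1\times E_2$ carries a standard product norm (e.g. $\|(x,y)\|=\|x\|+\|y\|$). Generalized approximating sequence: let $\{p_n\}\subset M$ with $p_n\to p^*$. A sequence $\{(x_n,y_n)\}$ in $E_1\times E_2$ is a generalized approximating sequence corresponding to $\{p_n\}$ for $SEP(f,g,C,Q)$ if there exists a sequence of positive numbers $\epsilon_n\to 0$ such that, for every $n$, $d(x_n,C)\le\epsilon_n$, $d(y_n,Q)\le\epsilon_n$, $\|y_n-Ax_n\|\le\epsilon_n$, $\tilde f(p_n,x_n,x)\ge-\epsilon_n$ for all $x\in C$, and $\tilde g(p_n,y_n,y)\ge-\epsilon_n$ for all $y\in Q$. Here $d(a,B)=\inf_{b\in B}\|a-b\|$. LP (Levitin-Polyak) well-posedness by perturbations in the generalized sense: $SEP(f,g,C,Q)$ is LP well-posed by perturbations in the generalized sense if $S\ne\emptyset$ and, for any $\{p_n\}\subset M$ with $p_n\to p^*$, every generalized approximating sequence corresponding to $\{p_n\}$ has a subsequence which converges to some element of $S$. Approximate solution set: for $\epsilon\ge 0$, $S(\epsilon)$ is the set of all $(z,w)\in E_1\times E_2$ for which there is $p\in M$ with $\|p-p^*\|\le\epsilon$ such that $d(z,C)\le\epsilon$, $d(w,Q)\le\epsilon$,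 $\|w-Az\|\le\epsilon$, $\tilde f(p,z,x)\ge-\epsilon$ for all $x\in C$, and $\tilde g(p,w,y)\ge-\epsilon$ for all $y\in Q$. Hausdorff metric: for nonempty sets $B_1,B_2$, $H(B_1,B_2)=\max\{D(B_1,B_2),D(B_2,B_1)\}$, where $D(B_1,B_2)=\sup_{a\in B_1}d(a,B_2)$ (values in $[0,\infty]$). *)

theory Defs
  imports "HOL-Analysis.Analysis"
begin

definition sep_solutions ::
  "('a \<Rightarrow> 'b) \<Rightarrow> ('a \<Rightarrow> 'a \<Rightarrow> real) \<Rightarrow> ('b \<Rightarrow> 'b \<Rightarrow> real) \<Rightarrow> 'a set \<Rightarrow> 'b set \<Rightarrow> ('a \<times> 'b) set"
  where
  "sep_solutions A f g C Q =
    {(x, y). x \<in> C \<and> y \<in> Q \<and> y = A x \<and> (\<forall>x'\<in>C. f x x' \<ge> 0) \<and> (\<forall>y'\<in>Q. g y y' \<ge> 0)}"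

text \<open>In the following definitions \<open>M\<close> is the set of perturbation parameters. The perturbed
  bifunctions \<open>ft\<close> and \<open>gt\<close> are total in the parameter, but they are only ever
  evaluated at parameters in \<open>M\<close>. The distance \<open>d(a, B)\<close> is \<^const>\<open>infdist\<close>, which is the infimum of
  the distances for nonempty \<open>B\<close> (and 0 for empty \<open>B\<close>).\<close>

definition gen_approx_seq ::
  "('a::real_normed_vector \<Rightarrow> 'b::real_normed_vector) \<Rightarrow>
   ('n \<Rightarrow> 'a \<Rightarrow> 'a \<Rightarrow> real) \<Rightarrow> ('n \<Rightarrow> 'b \<Rightarrow> 'b \<Rightarrow> real) \<Rightarrow> 'a set \<Rightarrow> 'b set \<Rightarrow>
   (nat \<Rightarrow> 'n) \<Rightarrow> (nat \<Rightarrow> 'a \<times> 'b) \<Rightarrow> bool"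
  where
  "gen_approx_seq A ft gt C Q p u \<longleftrightarrow>
    (\<exists>\<epsilon> :: nat \<Rightarrow> real. (\<forall>n. \<epsilon> n > 0) \<and> \<epsilon> \<longlonglongrightarrow> 0 \<and>
      (\<forall>n. infdist (fst (u n)) C \<le> \<epsilon> n \<and>
           infdist (snd (u n)) Q \<le> \<epsilon> n \<and>
           norm (snd (u n) - A (fst (u n))) \<le> \<epsilon> n \<and>
           (\<forall>x\<in>C. ft (p n) (fst (u n)) x \<ge> - \<epsilon> n) \<and>
           (\<forall>y\<in>Q. gt (p n) (snd (u n)) y \<ge> - \<epsilon> n)))"

definition LP_well_posed_gen ::
  "('a::real_normed_vector \<Rightarrow> 'b::real_normed_vector) \<Rightarrow>
   ('a \<Rightarrow> 'a \<Rightarrow> real) \<Rightarrow> ('b \<Rightarrow> 'b \<Rightarrow> real) \<Rightarrow>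
   ('n::real_normed_vector \<Rightarrow> 'a \<Rightarrow> 'a \<Rightarrow> real) \<Rightarrow> ('n \<Rightarrow> 'b \<Rightarrow> 'b \<Rightarrow> real) \<Rightarrow>
   'a set \<Rightarrow> 'b set \<Rightarrow> 'n set \<Rightarrow> 'n \<Rightarrow> bool"
  where
  "LP_well_posed_gen A f g ft gt C Q M pstar \<longleftrightarrow>
    sep_solutions A f g C Q \<noteq> {} \<and>
    (\<forall>p u. (\<forall>n. p n \<in> M) \<and> p \<longlonglongrightarrow> pstar \<and> gen_approx_seq A ft gt C Q p u \<longrightarrow>
      (\<exists>s\<in>sep_solutions A f g C Q. \<exists>r. strict_mono r \<and> (u \<circ> r) \<longlonglongrightarrow> s))"

definition approx_solutions ::
  "('a::real_normed_vector \<Rightarrow> 'b::real_normed_vector) \<Rightarrow>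
   ('n::real_normed_vector \<Rightarrow> 'a \<Rightarrow> 'a \<Rightarrow> real) \<Rightarrow> ('n \<Rightarrow> 'b \<Rightarrow> 'b \<Rightarrow> real) \<Rightarrow>
   'a set \<Rightarrow> 'b set \<Rightarrow> 'n set \<Rightarrow> 'n \<Rightarrow> real \<Rightarrow> ('a \<times> 'b) set"
  where
  "approx_solutions A ft gt C Q M pstar \<epsilon> =
    {(z, w). \<exists>p\<in>M. norm (p - pstar) \<le> \<epsilon> \<and>
      infdist z C \<le> \<epsilon> \<and> infdist w Q \<le> \<epsilon> \<and> norm (w - A z) \<le> \<epsilon> \<and>
      (\<forall>x\<in>C. ft p z x \<ge> - \<epsilon>) \<and> (\<forall>y\<in>Q. gt p w y \<ge> - \<epsilon>)}"

text \<open>The excess and the Hausdorff metric take values in \<open>[0, \<infinity>]\<close>; they are meaningful for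
  nonempty sets only. On a product space the metric comes from the library's product norm
  \<open>sqrt (\<parallel>x\<parallel>\<^sup>2 + \<parallel>y\<parallel>\<^sup>2)\<close>, which is equivalent to \<open>\<parallel>x\<parallel> + \<parallel>y\<parallel>\<close>.\<close>

definition excess :: "'a::metric_space set \<Rightarrow> 'a set \<Rightarrow> ennreal"
  where "excess B1 B2 = (SUP a\<in>B1. ennreal (infdist a B2))"

definition hausdorff_metric :: "'a::metric_space set \<Rightarrow> 'a set \<Rightarrow> ennreal"
  where "hausdorff_metric B1 B2 = max (excess B1 B2) (excess B2 B1)"

end

theory Submission
  imports Defs
begin

text \<open>Replacing \<open>\<epsilon>\<^sub>n\<close> by the maximum of \<open>\<epsilon>\<^sub>n\<close> and \<open>\<parallel>p\<^sub>n - p\<^sup>*\<parallel>\<close>, the generalized approximating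
  sequences are exactly the sequences \<open>u\<^sub>n \<in> S(\<epsilon>\<^sub>n)\<close> with positive \<open>\<epsilon>\<^sub>n \<rightarrow> 0\<close>. The theorem thereby
  reduces to a statement about an increasing family of supersets \<open>S(\<epsilon>)\<close> of \<open>S\<close> in a metric space:
  sequential compactness along the family amounts to compactness of \<open>S\<close> together with vanishing
  excess of \<open>S(\<epsilon>)\<close> over \<open>S\<close>; the opposite excess is zero.\<close>

lemma approx_solutions_mono:
  assumes "\<epsilon> \<le> \<eta>"
  shows "approx_solutions A ft gt C Q M pstar \<epsilon> \<subseteq> approx_solutions A ft gt C Q M pstar \<eta>"
proof
  fix u assume "u \<in> approx_solutions A ft gt C Q M pstar \<epsilon>"
  then obtain p where p: "p \<in> M" "norm (p - pstar) \<le> \<epsilon>"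
      "infdist (fst u) C \<le> \<epsilon>" "infdist (snd u) Q \<le> \<epsilon>" "norm (snd u - A (fst u)) \<le> \<epsilon>"
      "\<forall>x\<in>C. ft p (fst u) x \<ge> - \<epsilon>" "\<forall>y\<in>Q. gt p (snd u) y \<ge> - \<epsilon>"
    unfolding approx_solutions_def case_prod_beta by blast
  have "norm (p - pstar) \<le> \<eta>" "infdist (fst u) C \<le> \<eta>" "infdist (snd u) Q \<le> \<eta>"
      "norm (snd u - A (fst u)) \<le> \<eta>"
    using p(2-5) assms by linarith+
  moreover have "\<forall>x\<in>C. ft p (fst u) x \<ge> - \<eta>" "\<forall>y\<in>Q. gt p (snd u) y \<ge> - \<eta>"
    using p(6,7) assms by force+
  ultimately show "u \<in> approx_solutions A ft gt C Q M pstar \<eta>"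
    unfolding approx_solutions_def case_prod_beta using p(1) by blast
qed

text \<open>The witness parameter is \<open>pstar\<close> itself: there \<open>ft\<close> and
  \<open>gt\<close> coincide with \<open>f\<close> and \<open>g\<close>, and every distance in the
  definition is zero.\<close>

lemma sep_solutions_subset_approx_solutions:
  assumes "pstar \<in> M" "\<And>x x'. ft pstar x x' = f x x'" "\<And>y y'. gt pstar y y' = g y y'" "\<epsilon> \<ge> 0"
  shows "sep_solutions A f g C Q \<subseteq> approx_solutions A ft gt C Q M pstar \<epsilon>"
proof
  fix u assume "u \<in> sep_solutions A f g C Q"
  then have u: "fst u \<in> C" "snd u \<in> Q" "snd u = A (fst u)"
      "\<forall>x\<in>C. 0 \<le> f (fst u) x" "\<forall>y\<in>Q. 0 \<le> g (snd u) y"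
    unfolding sep_solutions_def case_prod_beta by blast+
  have "norm (pstar - pstar) \<le> \<epsilon>" "infdist (fst u) C \<le> \<epsilon>" "infdist (snd u) Q \<le> \<epsilon>"
      "norm (snd u - A (fst u)) \<le> \<epsilon>"
    using u(1-3) assms(4) by simp_all
  moreover have "\<forall>x\<in>C. ft pstar (fst u) x \<ge> - \<epsilon>" "\<forall>y\<in>Q. gt pstar (snd u) y \<ge> - \<epsilon>"
    unfolding assms(2,3) using u(4,5) assms(4) by force+
  ultimately show "u \<in> approx_solutions A ft gt C Q M pstar \<epsilon>"
    unfolding approx_solutions_def case_prod_beta using assms(1) by blast
qed

text \<open>This removes the parameters from the notion of approximating sequence. From right to
  left, a choice of witness parameters works with the same \<open>\<epsilon>\<close>, whose bound on
  the norm forces \<open>p\<close> to converge to \<open>pstar\<close>.\<close>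

lemma gen_approx_seq_iff_approx_solutions:
  "(\<exists>p. (\<forall>n. p n \<in> M) \<and> p \<longlonglongrightarrow> pstar \<and> gen_approx_seq A ft gt C Q p u) \<longleftrightarrow>
   (\<exists>\<epsilon>. (\<forall>n. \<epsilon> n > 0) \<and> \<epsilon> \<longlonglongrightarrow> 0 \<and> (\<forall>n. u n \<in> approx_solutions A ft gt C Q M pstar (\<epsilon> n)))"
  (is "?L \<longleftrightarrow> ?R")
proof
  assume ?L
  then obtain p \<epsilon> where p: "\<And>n. p n \<in> M" "p \<longlonglongrightarrow> pstar" and \<epsilon>: "\<And>n. \<epsilon> n > 0" "\<epsilon> \<longlonglongrightarrow> 0"
    and u: "\<And>n. infdist (fst (u n)) C \<le> \<epsilon> n" "\<And>n. infdist (snd (u n)) Q \<le> \<epsilon> n"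
      "\<And>n. norm (snd (u n) - A (fst (u n))) \<le> \<epsilon> n"
      "\<And>n x. x \<in> C \<Longrightarrow> ft (p n) (fst (u n)) x \<ge> - \<epsilon> n"
      "\<And>n y. y \<in> Q \<Longrightarrow> gt (p n) (snd (u n)) y \<ge> - \<epsilon> n"
    unfolding gen_approx_seq_def by blast
  define \<eta> where "\<eta> n = max (\<epsilon> n) (norm (p n - pstar))" for n
  have le: "\<epsilon> n \<le> \<eta> n" "norm (p n - pstar) \<le> \<eta> n" for n
    by (auto simp: \<eta>_def)
  have "(\<lambda>n. norm (p n - pstar)) \<longlonglongrightarrow> 0"
    using p(2) by (simp add: LIM_zero_iff tendsto_norm_zero_iff)
  then have "\<eta> \<longlonglongrightarrow> 0"
    unfolding \<eta>_def using tendsto_max[OF \<epsilon>(2)] by fastforce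
  moreover have "u n \<in> approx_solutions A ft gt C Q M pstar (\<eta> n)" for n
  proof -
    have "infdist (fst (u n)) C \<le> \<eta> n" "infdist (snd (u n)) Q \<le> \<eta> n"
        "norm (snd (u n) - A (fst (u n))) \<le> \<eta> n"
      using u(1-3)[of n] le(1)[of n] by linarith+
    moreover have "\<forall>x\<in>C. ft (p n) (fst (u n)) x \<ge> - \<eta> n" "\<forall>y\<in>Q. gt (p n) (snd (u n)) y \<ge> - \<eta> n"
      using u(4,5)[of _ n] le(1)[of n] by force+
    ultimately show ?thesis
      unfolding approx_solutions_def case_prod_beta using p(1)[of n] le(2)[of n] by blast
  qed
  moreover have "\<eta> n > 0" for n
    using \<epsilon>(1)[of n] le(1)[of n] by linarith
  ultimately show ?R by blast
next
  assume ?R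
  then obtain \<epsilon> where \<epsilon>: "\<And>n. \<epsilon> n > 0" "\<epsilon> \<longlonglongrightarrow> 0"
    and u: "\<And>n. u n \<in> approx_solutions A ft gt C Q M pstar (\<epsilon> n)" by blast
  from u have "\<forall>n. \<exists>q. q \<in> M \<and> norm (q - pstar) \<le> \<epsilon> n \<and>
      infdist (fst (u n)) C \<le> \<epsilon> n \<and> infdist (snd (u n)) Q \<le> \<epsilon> n \<and>
      norm (snd (u n) - A (fst (u n))) \<le> \<epsilon> n \<and>
      (\<forall>x\<in>C. ft q (fst (u n)) x \<ge> - \<epsilon> n) \<and> (\<forall>y\<in>Q. gt q (snd (u n)) y \<ge> - \<epsilon> n)"
    unfolding approx_solutions_def case_prod_beta by blast
  then obtain p where p: "\<forall>n. p n \<in> M \<and> norm (p n - pstar) \<le> \<epsilon> n \<and>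
      infdist (fst (u n)) C \<le> \<epsilon> n \<and> infdist (snd (u n)) Q \<le> \<epsilon> n \<and>
      norm (snd (u n) - A (fst (u n))) \<le> \<epsilon> n \<and>
      (\<forall>x\<in>C. ft (p n) (fst (u n)) x \<ge> - \<epsilon> n) \<and> (\<forall>y\<in>Q. gt (p n) (snd (u n)) y \<ge> - \<epsilon> n)"
    unfolding choice_iff by (elim exE)
  have "(\<lambda>n. p n - pstar) \<longlonglongrightarrow> 0"
    using p by (intro Lim_null_comparison[OF _ \<epsilon>(2)] always_eventually) blast
  then have "p \<longlonglongrightarrow> pstar"
    by (simp add: LIM_zero_iff)
  moreover have "gen_approx_seq A ft gt C Q p u"
    unfolding gen_approx_seq_def using p \<epsilon> by blast
  ultimately show ?L using p by blast
qed

lemma infdist_le_excess: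
  assumes "a \<in> B1"
  shows "ennreal (infdist a B2) \<le> excess B1 B2"
  unfolding excess_def using assms by (rule SUP_upper)

lemma excess_le_iff:
  assumes "\<delta> \<ge> 0"
  shows "excess B1 B2 \<le> ennreal \<delta> \<longleftrightarrow> (\<forall>a\<in>B1. infdist a B2 \<le> \<delta>)"
  unfolding excess_def using assms by (simp add: SUP_le_iff ennreal_le_iff)

text \<open>Points of \<open>B2\<close> are at distance zero from \<open>B1\<close>, so only the
  excess of the larger set can be nonzero.\<close>

lemma hausdorff_metric_superset:
  assumes "B2 \<subseteq> B1"
  shows "hausdorff_metric B1 B2 = excess B1 B2"
proof -
  have "excess B2 B1 \<le> ennreal 0"
    using assms by (subst excess_le_iff) auto
  then show ?thesis by (simp add: hausdorff_metric_def)
qed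

text \<open>A supremum is at most \<delta> exactly when all its terms are, so a limit in
  \<open>ennreal\<close> becomes a uniform bound on real distances.\<close>

lemma excess_tendsto_0_iff:
  fixes T :: "real \<Rightarrow> 'a::metric_space set"
  shows "((\<lambda>\<epsilon>. excess (T \<epsilon>) S) \<longlongrightarrow> 0) F \<longleftrightarrow>
    (\<forall>\<delta>>0. \<forall>\<^sub>F \<epsilon> in F. \<forall>a\<in>T \<epsilon>. infdist a S \<le> \<delta>)" (is "?L \<longleftrightarrow> ?R")
proof
  assume L: ?L
  show ?R
  proof (intro allI impI)
    fix \<delta> :: real assume \<delta>: "\<delta> > 0"
    have "\<forall>\<^sub>F \<epsilon> in F. excess (T \<epsilon>) S < ennreal \<delta>"
      using order_tendstoD(2)[OF L] \<delta> by simp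
    then show "\<forall>\<^sub>F \<epsilon> in F. \<forall>a\<in>T \<epsilon>. infdist a S \<le> \<delta>"
      by eventually_elim (use \<delta> excess_le_iff in \<open>metis less_imp_le\<close>)
  qed
next
  assume R: ?R
  show ?L
  proof (rule order_tendstoI)
    fix a :: ennreal assume "a > 0"
    \<comment> \<open>Bounds on the single distances give only a non-strict bound on their supremum,
      hence the room between \<open>b\<close> and \<open>a\<close>. Lying below \<open>a\<close>,
      the value \<open>b\<close> is finite even if \<open>a\<close> is infinite, so it comes from a
      real \<delta>.\<close>
    then obtain b where b: "0 < b" "b < a" using dense by blast
    then obtain \<delta> where \<delta>: "b = ennreal \<delta>" "\<delta> > 0"
      by (cases b) auto
    have "\<forall>\<^sub>F \<epsilon> in F. \<forall>a\<in>T \<epsilon>. infdist a S \<le> \<delta>" using R \<delta> by blast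
    then show "\<forall>\<^sub>F \<epsilon> in F. excess (T \<epsilon>) S < a"
    proof eventually_elim
      case (elim \<epsilon>)
      then have "excess (T \<epsilon>) S \<le> b"
        unfolding \<delta>(1) using \<delta>(2) by (subst excess_le_iff) auto
      with b(2) show ?case by (rule order_le_less_trans[rotated])
    qed
  qed auto
qed

lemma infdist_attains_inf_compact:
  fixes S :: "'a::metric_space set"
  assumes "compact S" "S \<noteq> {}"
  obtains s where "s \<in> S" "infdist a S = dist a s"
proof -
  have "continuous_on S (\<lambda>y. dist a y)"
    by (intro continuous_intros)
  then obtain s where s: "s \<in> S" "\<forall>y\<in>S. dist a s \<le> dist a y"
    using continuous_attains_inf[OF assms] by blast
  have "infdist a S = dist a s"
    unfolding infdist_notempty[OF \<open>S \<noteq> {}\<close>] using s by (intro cInf_eq_minimum) auto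
  with s(1) show thesis by (rule that)
qed

text \<open>The points \<open>u n\<close> need not lie in a compact set, but their nearest points
  \<open>v n\<close> lie in \<open>S\<close>. A subsequence of \<open>v\<close> converges by
  compactness, and the triangle inequality carries its limit over to \<open>u\<close>.\<close>

lemma convergent_subsequence_of_infdist:
  fixes S :: "'a::metric_space set"
  assumes "compact S" "S \<noteq> {}" "(\<lambda>n. infdist (u n) S) \<longlonglongrightarrow> 0"
  shows "\<exists>s\<in>S. \<exists>r. strict_mono r \<and> (u \<circ> r) \<longlonglongrightarrow> s"
proof -
  have "\<forall>n. \<exists>s. s \<in> S \<and> infdist (u n) S = dist (u n) s"
    by (meson infdist_attains_inf_compact assms(1,2))
  then obtain v where v: "\<And>n. v n \<in> S" "\<And>n. infdist (u n) S = dist (u n) (v n)"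
    unfolding choice_iff by blast
  then obtain s r where s: "s \<in> S" "strict_mono r" "(v \<circ> r) \<longlonglongrightarrow> s"
    using \<open>compact S\<close> unfolding compact_eq_seq_compact_metric seq_compact_def by metis
  have "(\<lambda>n. dist (u (r n)) (v (r n))) \<longlonglongrightarrow> 0"
    using LIMSEQ_subseq_LIMSEQ[OF assms(3) s(2)] v(2) by (simp add: o_def)
  moreover have "(\<lambda>n. dist (v (r n)) s) \<longlonglongrightarrow> 0"
    using s(3) unfolding o_def by (subst (asm) tendsto_dist_iff)
  ultimately have "(\<lambda>n. dist (u (r n)) (v (r n)) + dist (v (r n)) s) \<longlonglongrightarrow> 0"
    by (rule tendsto_add_zero)
  then have "(\<lambda>n. dist (u (r n)) s) \<longlonglongrightarrow> 0"
    by (rule Lim_null_comparison[rotated]) (simp add: dist_triangle)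
  then have "(u \<circ> r) \<longlonglongrightarrow> s"
    unfolding o_def by (subst tendsto_dist_iff)
  then show ?thesis
    using s by blast
qed

text \<open>From left to right, the subsequence property is tested on two kinds of sequences: those
  inside \<open>S\<close> give compactness, and those staying away from \<open>S\<close> would
  contradict it if the excess did not vanish. From right to left, the excess bounds the distance of
  \<open>u n\<close> to \<open>S\<close>, and compactness supplies the limit.\<close>

lemma subsequences_iff_compact_excess:
  fixes T :: "real \<Rightarrow> 'a::metric_space set"
  assumes mono: "\<And>\<epsilon> \<eta>. \<epsilon> \<le> \<eta> \<Longrightarrow> T \<epsilon> \<subseteq> T \<eta>"
    and sub: "\<And>\<epsilon>. \<epsilon> > 0 \<Longrightarrow> S \<subseteq> T \<epsilon>" and "S \<noteq> {}"
  shows "(\<forall>u \<epsilon>. (\<forall>n. \<epsilon> n > 0) \<and> \<epsilon> \<longlonglongrightarrow> 0 \<and> (\<forall>n. u n \<in> T (\<epsilon> n)) \<longrightarrow>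
      (\<exists>s\<in>S. \<exists>r. strict_mono r \<and> (u \<circ> r) \<longlonglongrightarrow> s)) \<longleftrightarrow>
    compact S \<and> ((\<lambda>\<epsilon>. excess (T \<epsilon>) S) \<longlongrightarrow> 0) (at_right 0)" (is "?L \<longleftrightarrow> ?R")
proof
  assume L: ?L
  define e :: "nat \<Rightarrow> real" where "e n = inverse (real (Suc n))" for n
  have e: "e n > 0" for n by (simp add: e_def)
  have e0: "e \<longlonglongrightarrow> 0" unfolding e_def by (rule LIMSEQ_inverse_real_of_nat)
  have sub_seq: "\<exists>s\<in>S. \<exists>r. strict_mono r \<and> (u \<circ> r) \<longlonglongrightarrow> s" if "\<And>n. u n \<in> T (e n)" for u
    using L e e0 that by blast
  \<comment> \<open>By \<open>sub\<close>, any sequence in \<open>S\<close> has its terms in the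
    sets \<open>T (e n)\<close>, so \<open>sub_seq\<close> applies to it.\<close>
  have "compact S"
    unfolding compact_eq_seq_compact_metric seq_compact_def
    using sub_seq sub[OF e] by (meson subsetD)
  moreover have "\<forall>\<^sub>F \<epsilon> in at_right 0. \<forall>a\<in>T \<epsilon>. infdist a S \<le> \<delta>" if \<delta>: "\<delta> > 0" for \<delta>
  proof -
    \<comment> \<open>One good index is enough, because \<open>mono\<close> passes its bound on to
      every \<epsilon> below \<open>e n\<close>.\<close>
    have "\<exists>n. \<forall>a\<in>T (e n). infdist a S \<le> \<delta>"
    proof (rule ccontr)
      assume "\<not> ?thesis"
      then have "\<forall>n. \<exists>a. a \<in> T (e n) \<and> infdist a S > \<delta>"
        by (auto simp: not_le)
      then obtain u where u: "\<And>n. u n \<in> T (e n)" "\<And>n. infdist (u n) S > \<delta>"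
        unfolding choice_iff by blast
      obtain s r where s: "s \<in> S" "(u \<circ> r) \<longlonglongrightarrow> s"
        using sub_seq[OF u(1)] by blast
      \<comment> \<open>The distance to \<open>S\<close> is continuous, so values above \<delta>
        cannot tend to the distance of \<open>s\<close>, which is zero.\<close>
      have "(\<lambda>n. infdist ((u \<circ> r) n) S) \<longlonglongrightarrow> infdist s S"
        using s(2) by (rule tendsto_infdist)
      then have "\<delta> \<le> infdist s S"
        by (rule LIMSEQ_le_const) (simp add: less_imp_le[OF u(2)])
      then show False using s \<delta> by simp
    qed
    then obtain n where n: "\<forall>a\<in>T (e n). infdist a S \<le> \<delta>" ..
    show ?thesis
    proof (rule eventually_at_rightI[OF _ e[of n]])
      fix \<epsilon> assume "\<epsilon> \<in> {0<..<e n}"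
      then have "T \<epsilon> \<subseteq> T (e n)" by (intro mono) simp
      with n show "\<forall>a\<in>T \<epsilon>. infdist a S \<le> \<delta>" by blast
    qed
  qed
  ultimately show ?R unfolding excess_tendsto_0_iff by blast
next
  assume R: ?R
  show ?L
  proof (intro allI impI, elim conjE)
    fix u \<epsilon> assume \<epsilon>: "\<forall>n. \<epsilon> n > (0::real)" "\<epsilon> \<longlonglongrightarrow> 0" and u: "\<forall>n. u n \<in> T (\<epsilon> n)"
    \<comment> \<open>Positivity of all \<open>\<epsilon> n\<close> makes the convergence one-sided,
      which is where the excess is known to vanish.\<close>
    have "filterlim \<epsilon> (at_right 0) sequentially"
      using \<epsilon> by (intro tendsto_imp_filterlim_at_right) auto
    then have lim: "(\<lambda>n. excess (T (\<epsilon> n)) S) \<longlonglongrightarrow> 0"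
      by (rule filterlim_compose[OF conjunct2[OF R]])
    \<comment> \<open>The squeeze takes place in \<open>ennreal\<close>, since the excess may be
      infinite; only the distances are then moved back to the reals.\<close>
    have "\<forall>\<^sub>F n in sequentially. ennreal (infdist (u n) S) \<le> excess (T (\<epsilon> n)) S"
      using u by (simp add: infdist_le_excess)
    then have "(\<lambda>n. ennreal (infdist (u n) S)) \<longlonglongrightarrow> 0"
      by (rule tendsto_sandwich[OF always_eventually[OF allI[OF zero_le]] _ tendsto_const lim])
    then have "(\<lambda>n. infdist (u n) S) \<longlonglongrightarrow> 0"
      unfolding ennreal_0[symmetric] by (subst (asm) tendsto_ennreal_iff) (simp_all add: infdist_nonneg)
    then show "\<exists>s\<in>S. \<exists>r. strict_mono r \<and> (u \<circ> r) \<longlonglongrightarrow> s"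
      using R \<open>S \<noteq> {}\<close> convergent_subsequence_of_infdist by blast
  qed
qed

theorem theorem6:
  fixes A :: "'a::banach \<Rightarrow> 'b::banach"
    and f :: "'a \<Rightarrow> 'a \<Rightarrow> real" and g :: "'b \<Rightarrow> 'b \<Rightarrow> real"
    and C :: "'a set" and Q :: "'b set"
    and M :: "'n::real_normed_vector set" and pstar :: 'n and \<rho> :: real
    and ft :: "'n \<Rightarrow> 'a \<Rightarrow> 'a \<Rightarrow> real" and gt :: "'n \<Rightarrow> 'b \<Rightarrow> 'b \<Rightarrow> real"
  assumes "C \<noteq> {}" "closed C" "convex C"
    and "Q \<noteq> {}" "closed Q" "convex Q"
    and "bounded_linear A"
    and "\<rho> > 0" "M = cball pstar \<rho>"
    and "\<And>x x'. ft pstar x x' = f x x'"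
    and "\<And>y y'. gt pstar y y' = g y y'"
  shows "LP_well_posed_gen A f g ft gt C Q M pstar \<longleftrightarrow>
    sep_solutions A f g C Q \<noteq> {} \<and> compact (sep_solutions A f g C Q) \<and>
    ((\<lambda>\<epsilon>. hausdorff_metric (approx_solutions A ft gt C Q M pstar \<epsilon>) (sep_solutions A f g C Q))
      \<longlongrightarrow> 0) (at_right 0)"
proof -
  define S where "S = sep_solutions A f g C Q"
  define T where "T = approx_solutions A ft gt C Q M pstar"
  have mono: "T \<epsilon> \<subseteq> T \<eta>" if "\<epsilon> \<le> \<eta>" for \<epsilon> \<eta>
    unfolding T_def using that by (rule approx_solutions_mono)
  have sub: "S \<subseteq> T \<epsilon>" if "\<epsilon> > 0" for \<epsilon>
    unfolding S_def T_def using assms(8-11) that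
    by (intro sep_solutions_subset_approx_solutions) auto
  \<comment> \<open>The conclusion about subsequences does not mention \<open>p\<close>, so the
    universal quantifier over \<open>p\<close> turns into an existential one in the premise.\<close>
  have "LP_well_posed_gen A f g ft gt C Q M pstar \<longleftrightarrow> S \<noteq> {} \<and>
    (\<forall>u. (\<exists>p. (\<forall>n. p n \<in> M) \<and> p \<longlonglongrightarrow> pstar \<and> gen_approx_seq A ft gt C Q p u) \<longrightarrow>
      (\<exists>s\<in>S. \<exists>r. strict_mono r \<and> (u \<circ> r) \<longlonglongrightarrow> s))"
    unfolding LP_well_posed_gen_def S_def by blast
  also have "\<dots> \<longleftrightarrow> S \<noteq> {} \<and>
    (\<forall>u \<epsilon>. (\<forall>n. \<epsilon> n > 0) \<and> \<epsilon> \<longlonglongrightarrow> 0 \<and> (\<forall>n. u n \<in> T (\<epsilon> n)) \<longrightarrow>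
      (\<exists>s\<in>S. \<exists>r. strict_mono r \<and> (u \<circ> r) \<longlonglongrightarrow> s))"
    unfolding gen_approx_seq_iff_approx_solutions T_def by blast
  also have "\<dots> \<longleftrightarrow> S \<noteq> {} \<and> compact S \<and> ((\<lambda>\<epsilon>. excess (T \<epsilon>) S) \<longlongrightarrow> 0) (at_right 0)"
    using subsequences_iff_compact_excess[of T S, OF mono sub] by blast
  \<comment> \<open>The filter sees positive \<epsilon> only, where \<open>S\<close> is contained in
    \<open>T \<epsilon>\<close> and both quantities agree; the endpoint 1 is an arbitrary
    choice.\<close>
  also have "((\<lambda>\<epsilon>. excess (T \<epsilon>) S) \<longlongrightarrow> 0) (at_right 0) \<longleftrightarrow>
      ((\<lambda>\<epsilon>. hausdorff_metric (T \<epsilon>) S) \<longlongrightarrow> 0) (at_right 0)"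
    using sub
    by (intro filterlim_cong refl eventually_at_rightI[of 0 1]) (auto simp: hausdorff_metric_superset)
  finally show ?thesis unfolding S_def T_def .
qed

end
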